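(* Let $L$ be an $n$-Lie algebra over a field $F$, let $A=(\mu_A,\lambda_A)$ be an intuitionistic fuzzy $n$-Lie ideal of $L$, and let $L/A=\{x+A : x\in L\}$ be the set of all cosets of $A$. Then $L/A$ is an $n$-Lie algebra over $F$ under the following operations: (i) $(x+A)+(y+A)=(x+y)+A$ for all $x,y\in L$; (ii) $\alpha(x+A)=\alpha x+A$ for all $x\in L$ and $\alpha\in F$; (iii) $[(x_1+A),(x_2+A),\ldots,(x_n+A)]=[x_1,x_2,\ldots,x_n]+A$ for all $x_1,\ldots,x_n\in L$.
   Context: Let $n\ge 2$ be an integer and $F$ an arbitrary field. An $n$-Lie algebra over $F$ is an $F$-vector space $L$ with an $n$-linear map $[\,]:L^n\to L$, $(x_1,\ldots,x_n)\mapsto[x_1,\ldots,x_n]$, such that for all $\sigma\in S_n$ and all $x_1,\ldots,x_n,y_2,\ldots,y_n\in L$: (i) $[x_{\sigma(1)},\ldots,x_{\sigma(n)}]=\mathrm{sign}(\sigma)[x_1,\ldots,x_n]$; (ii) $[[x_1,\ldots,x_n],y_2,\ldots,y_n]=\sum_{i=1}^n[x_1,\ldots,x_{i-1},[x_i,y_2,\ldots,y_n],x_{i+1},\ldots,x_n]$. An intuitionistic fuzzy set on a non-empty set $X$ is a pair $A=(\mu_A,\lambda_A)$ of maps $\mu_A,\lambda_A:X\to[0,1]$ with $\mu_A(x)+\lambda_A(x)\le 1$ for all $x\in X$. Write $a\wedge b=\min\{a,b\}$ and $a\vee b=\max\{a,b\}$. An intuitionistic fuzzy set $A=(\mu_A,\lambda_A)$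 on $L$ is an intuitionistic fuzzy $n$-Lie ideal of $L$ if for all $x,y,x_1,\ldots,x_n\in L$ and $\alpha\in F$: (i) $\mu_A(x+y)\ge\mu_A(x)\wedge\mu_A(y)$ and $\lambda_A(x+y)\le\lambda_A(x)\vee\lambda_A(y)$; (ii) $\mu_A(\alpha x)\ge\mu_A(x)$ and $\lambda_A(\alpha x)\le\lambda_A(x)$; (iii)' $\mu_A([x_1,\ldots,x_n])\ge\mu_A(x_1)\vee\cdots\vee\mu_A(x_n)$ and $\lambda_A([x_1,\ldots,x_n])\le\lambda_A(x_1)\wedge\cdots\wedge\lambda_A(x_n)$. For $x\in L$, the coset $x+A$ is the pair of functions $(x+\mu_A,\,x+\lambda_A)$ on $L$ given by $(x+\mu_A)(y)=\mu_A(y-x)$ and $(x+\lambda_A)(y)=\lambda_A(y-x)$ for $y\in L$; two cosets are equal when both component functions are equal. *)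

theory Defs
  imports "HOL-Algebra.Module" "HOL-Combinatorics.Permutations" Complex_Main
begin

(* As in HOL-Algebra modules, the multiplicative ring components of the record are unused.
   The n-ary bracket takes its arguments as a list; only its values on lists of length n over
   the carrier matter. *)
record ('f, 'a) n_lie = "('f, 'a) module" +
  bracket :: "'a list \<Rightarrow> 'a"

locale n_Lie_algebra = field F + Module.module F L
  for n :: nat and F (structure) and L :: "('f, 'a, 'b) n_lie_scheme" (structure) +
  assumes arity: "n \<ge> 2"
    and bracket_closed:
      "\<lbrakk>length xs = n; set xs \<subseteq> carrier L\<rbrakk> \<Longrightarrow> bracket L xs \<in> carrier L"
    and bracket_add:
      "\<lbrakk>length xs = n; set xs \<subseteq> carrier L; i < n; x \<in> carrier L; y \<in> carrier L\<rbrakk> \<Longrightarrow>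
        bracket L (xs[i := x \<oplus>\<^bsub>L\<^esub> y]) = bracket L (xs[i := x]) \<oplus>\<^bsub>L\<^esub> bracket L (xs[i := y])"
    and bracket_smult:
      "\<lbrakk>length xs = n; set xs \<subseteq> carrier L; i < n; a \<in> carrier F; x \<in> carrier L\<rbrakk> \<Longrightarrow>
        bracket L (xs[i := a \<odot>\<^bsub>L\<^esub> x]) = a \<odot>\<^bsub>L\<^esub> bracket L (xs[i := x])"
    and bracket_permute:
      "\<lbrakk>length xs = n; set xs \<subseteq> carrier L; \<sigma> permutes {..<n}\<rbrakk> \<Longrightarrow>
        bracket L (permute_list \<sigma> xs) = [sign \<sigma>] \<cdot>\<^bsub>L\<^esub> bracket L xs"
    and bracket_bracket:
      "\<lbrakk>length xs = n; set xs \<subseteq> carrier L; length ys = n - 1; set ys \<subseteq> carrier L\<rbrakk> \<Longrightarrow>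
        bracket L (bracket L xs # ys) =
          (\<Oplus>\<^bsub>L\<^esub>i\<in>{..<n}. bracket L (xs[i := bracket L (xs ! i # ys)]))"

definition intuitionistic_fuzzy_set :: "'a set \<Rightarrow> ('a \<Rightarrow> real) \<times> ('a \<Rightarrow> real) \<Rightarrow> bool" where
  "intuitionistic_fuzzy_set X = (\<lambda>(\<mu>, \<nu>). X \<noteq> {} \<and>
     (\<forall>x\<in>X. \<mu> x \<in> {0..1} \<and> \<nu> x \<in> {0..1} \<and> \<mu> x + \<nu> x \<le> 1))"

definition intuitionistic_fuzzy_n_Lie_ideal ::
  "nat \<Rightarrow> ('f, 'c) ring_scheme \<Rightarrow> ('f, 'a, 'b) n_lie_scheme \<Rightarrow>
    ('a \<Rightarrow> real) \<times> ('a \<Rightarrow> real) \<Rightarrow> bool" where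
  "intuitionistic_fuzzy_n_Lie_ideal n F L = (\<lambda>(\<mu>, \<nu>).
     intuitionistic_fuzzy_set (carrier L) (\<mu>, \<nu>) \<and>
     (\<forall>x\<in>carrier L. \<forall>y\<in>carrier L.
        \<mu> (x \<oplus>\<^bsub>L\<^esub> y) \<ge> min (\<mu> x) (\<mu> y) \<and> \<nu> (x \<oplus>\<^bsub>L\<^esub> y) \<le> max (\<nu> x) (\<nu> y)) \<and>
     (\<forall>a\<in>carrier F. \<forall>x\<in>carrier L.
        \<mu> (a \<odot>\<^bsub>L\<^esub> x) \<ge> \<mu> x \<and> \<nu> (a \<odot>\<^bsub>L\<^esub> x) \<le> \<nu> x) \<and>
     (\<forall>xs. length xs = n \<and> set xs \<subseteq> carrier L \<longrightarrow>
        \<mu> (bracket L xs) \<ge> Max (\<mu> ` set xs) \<and> \<nu> (bracket L xs) \<le> Min (\<nu> ` set xs)))"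

(* The component functions are restricted to the carrier (and undefined outside it), so that
   HOL equality of cosets is equality of functions on L. *)
definition fuzzy_coset ::
  "('f, 'a, 'b) n_lie_scheme \<Rightarrow> ('a \<Rightarrow> real) \<times> ('a \<Rightarrow> real) \<Rightarrow> 'a \<Rightarrow>
    ('a \<Rightarrow> real) \<times> ('a \<Rightarrow> real)" where
  "fuzzy_coset L = (\<lambda>(\<mu>, \<nu>) x.
     (\<lambda>y\<in>carrier L. \<mu> (y \<ominus>\<^bsub>L\<^esub> x), \<lambda>y\<in>carrier L. \<nu> (y \<ominus>\<^bsub>L\<^esub> x)))"

end

theory Submission
  imports Defs "HOL-Algebra.AbelCoset"
begin

text \<open>Two cosets \<^term>\<open>x + A\<close> and \<^term>\<open>y + A\<close> agree iff both membership functions take at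
  \<^term>\<open>x - y\<close> the extreme value that they take at \<^term>\<open>0\<close>. Hence equality of cosets is a
  congruence for the operations of \<^term>\<open>L\<close>; for the bracket this is checked one argument at a
  time, using multilinearity. The operations descend to the cosets, and every identity of
  \<^term>\<open>L\<close> passes to its image.\<close>

section \<open>Transport of n-Lie algebra structures along maps\<close>

text \<open>Every element and every list over \<open>carrier Q\<close> has a preimage in
  \<open>L\<close>, so each axiom for \<open>Q\<close> is the image under \<open>h\<close> of the
  same axiom for \<open>L\<close>. Nothing algebraic is presupposed about \<open>Q\<close>: its
  group and module laws are obtained in the same way before the bracket is treated.\<close>

lemma n_Lie_algebra_hom_image:
  fixes F :: "('f, 'c) ring_scheme"
    and L :: "('f, 'a, 'b) n_lie_scheme" and Q :: "('f, 'd, 'e) n_lie_scheme"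
  assumes "n_Lie_algebra n F L"
    and carrier: "carrier Q = h ` carrier L"
    and zero: "h \<zero>\<^bsub>L\<^esub> = \<zero>\<^bsub>Q\<^esub>"
    and add: "\<And>x y. \<lbrakk>x \<in> carrier L; y \<in> carrier L\<rbrakk> \<Longrightarrow> h (x \<oplus>\<^bsub>L\<^esub> y) = h x \<oplus>\<^bsub>Q\<^esub> h y"
    and smult: "\<And>a x. \<lbrakk>a \<in> carrier F; x \<in> carrier L\<rbrakk> \<Longrightarrow> h (a \<odot>\<^bsub>L\<^esub> x) = a \<odot>\<^bsub>Q\<^esub> h x"
    and bracket: "\<And>xs. \<lbrakk>length xs = n; set xs \<subseteq> carrier L\<rbrakk> \<Longrightarrow>
      h (bracket L xs) = bracket Q (map h xs)"
  shows "n_Lie_algebra n F Q"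
proof -
  interpret L: n_Lie_algebra n F L by fact
  have upd: "set (xs[i := x]) \<subseteq> carrier L" if "set xs \<subseteq> carrier L" "x \<in> carrier L" for xs i x
    using that set_update_subset_insert by fast
  interpret Q: abelian_group Q
  proof (rule abelian_groupI)
    fix u assume "u \<in> carrier Q"
    then obtain x where x: "u = h x" "x \<in> carrier L" by (auto simp: carrier)
    then have "h (\<ominus>\<^bsub>L\<^esub> x) \<oplus>\<^bsub>Q\<^esub> u = \<zero>\<^bsub>Q\<^esub>"
      by (simp add: L.l_neg zero flip: add)
    then show "\<exists>v\<in>carrier Q. v \<oplus>\<^bsub>Q\<^esub> u = \<zero>\<^bsub>Q\<^esub>" using x by (auto simp: carrier)
  qed (auto simp: carrier L.M.a_ac simp flip: add zero)
  interpret H: abelian_group_hom L Q h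
    using L.M.a_group Q.a_group add
    by (intro abelian_group_homI L.M.abelian_group_axioms Q.abelian_group_axioms group_hom.intro
      group_hom_axioms.intro) (auto simp: hom_def carrier)
  interpret Q: Module.module F Q
    by (rule moduleI) (auto simp: carrier L.smult_l_distr L.smult_r_distr L.smult_assoc1
      L.cring_axioms Q.abelian_group_axioms simp flip: add smult)
  have finsum: "h (finsum L f I) = (\<Oplus>\<^bsub>Q\<^esub>i\<in>I. h (f i))"
    if "finite I" "f \<in> I \<rightarrow> carrier L" for f and I :: "nat set"
    using that by (induction I) (auto simp: zero add carrier Pi_iff)
  \<comment> \<open>The sign in \<open>bracket_permute\<close> acts as an integer multiple, that is,
    as an integer power in the additive group; group homomorphisms preserve these.\<close>
  have pow: "h ([k] \<cdot>\<^bsub>L\<^esub> x) = [k] \<cdot>\<^bsub>Q\<^esub> h x" if "x \<in> carrier L" for k :: int and x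
    using group_hom.hom_int_pow[OF H.a_group_hom, of x k] that by (simp add: add_pow_def)
  have lift: "\<exists>xs. us = map h xs \<and> set xs \<subseteq> carrier L" if "set us \<subseteq> carrier Q" for us
    using that lists_image[of h "carrier L"] unfolding carrier lists_eq_set by auto
  show ?thesis
  proof (intro n_Lie_algebra.intro n_Lie_algebra_axioms.intro)
    show "field F" "Module.module F Q" "n \<ge> 2"
      by (fact L.field_axioms Q.module_axioms L.arity)+
  next
    fix us assume us: "length us = n" "set us \<subseteq> carrier Q"
    then obtain xs where xs: "us = map h xs" "set xs \<subseteq> carrier L" "length xs = n"
      using lift by fastforce
    then show "bracket Q us \<in> carrier Q"
      by (simp add: carrier L.bracket_closed flip: bracket)
    show "bracket Q (us[i := u \<oplus>\<^bsub>Q\<^esub> v]) = bracket Q (us[i := u]) \<oplus>\<^bsub>Q\<^esub> bracket Q (us[i := v])"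
      if uv: "i < n" "u \<in> carrier Q" "v \<in> carrier Q" for i u v
    proof -
      obtain x y where "u = h x" "x \<in> carrier L" "v = h y" "y \<in> carrier L"
        using uv by (auto simp: carrier)
      then show ?thesis
        using xs uv upd L.bracket_closed
        by (simp add: L.bracket_add map_update[symmetric] flip: add bracket)
    qed
    show "bracket Q (us[i := a \<odot>\<^bsub>Q\<^esub> u]) = a \<odot>\<^bsub>Q\<^esub> bracket Q (us[i := u])"
      if au: "i < n" "a \<in> carrier F" "u \<in> carrier Q" for i a u
    proof -
      obtain x where "u = h x" "x \<in> carrier L"
        using au by (auto simp: carrier)
      then show ?thesis
        using xs au upd L.bracket_closed
        by (simp add: L.bracket_smult map_update[symmetric] flip: smult bracket)
    qed
    show "bracket Q (permute_list \<sigma> us) = [sign \<sigma>] \<cdot>\<^bsub>Q\<^esub> bracket Q us"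
      if \<sigma>: "\<sigma> permutes {..<n}" for \<sigma>
      using xs \<sigma> L.bracket_closed
      by (simp add: permute_list_map L.bracket_permute flip: bracket pow)
    show "bracket Q (bracket Q us # vs) =
        (\<Oplus>\<^bsub>Q\<^esub>i\<in>{..<n}. bracket Q (us[i := bracket Q (us ! i # vs)]))"
      if vs: "length vs = n - 1" "set vs \<subseteq> carrier Q" for vs
    proof -
      obtain ys where ys: "vs = map h ys" "set ys \<subseteq> carrier L" "length ys = n - 1"
        using lift vs by fastforce
      \<comment> \<open>Since \<open>n - 1\<close> is truncated subtraction, the arity bound is what
        gives an element followed by \<open>ys\<close> the length \<open>n\<close>.\<close>
      have n: "Suc (n - 1) = n" using L.arity by simp
      have nth: "xs ! i \<in> carrier L" if "i < n" for i
        using xs that by (auto dest: nth_mem)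
      have inner: "bracket L (xs ! i # ys) \<in> carrier L" if "i < n" for i
        using nth[OF that] ys n by (intro L.bracket_closed) auto
      have "bracket Q (bracket Q us # vs) = h (bracket L (bracket L xs # ys))"
        using xs ys n L.bracket_closed by (simp add: bracket)
      also have "\<dots> = (\<Oplus>\<^bsub>Q\<^esub>i\<in>{..<n}. h (bracket L (xs[i := bracket L (xs ! i # ys)])))"
        using xs ys inner upd L.bracket_closed by (simp add: L.bracket_bracket finsum)
      also have "\<dots> = (\<Oplus>\<^bsub>Q\<^esub>i\<in>{..<n}. bracket Q (us[i := bracket Q (us ! i # vs)]))"
      \<comment> \<open>Besides termwise equality, this rule asks that the terms of the right-hand
        sum lie in the carrier; each is exhibited as a value of \<open>h\<close>.\<close>
      proof (rule Q.finsum_cong')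
        show "(\<lambda>i. bracket Q (us[i := bracket Q (us ! i # vs)])) \<in> {..<n} \<rightarrow> carrier Q"
        proof
          fix i assume i: "i \<in> {..<n}"
          have "bracket Q (us[i := bracket Q (us ! i # vs)]) =
              h (bracket L (xs[i := bracket L (xs ! i # ys)]))"
            using i xs ys n nth inner upd by (simp add: bracket map_update)
          then show "bracket Q (us[i := bracket Q (us ! i # vs)]) \<in> carrier Q"
            using i xs inner upd L.bracket_closed by (simp add: carrier)
        qed
      qed (use xs ys n nth inner upd in \<open>simp_all add: bracket map_update\<close>)
      finally show ?thesis .
    qed
  qed
qed

text \<open>If having equal values under \<open>h\<close> is a congruence, the operations computed
  on arbitrary preimages are well defined on the image of \<open>h\<close>, and \<open>h\<close>
  becomes a homomorphism onto it. The bracket hypothesis varies one argument only, which is the form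
  that multilinearity yields.\<close>

lemma n_Lie_algebra_quotient:
  fixes F :: "('f, 'c) ring_scheme" and L :: "('f, 'a, 'b) n_lie_scheme" and h :: "'a \<Rightarrow> 'd"
  assumes "n_Lie_algebra n F L"
    and add: "\<And>x x' y y'. \<lbrakk>x \<in> carrier L; x' \<in> carrier L; y \<in> carrier L; y' \<in> carrier L;
      h x = h x'; h y = h y'\<rbrakk> \<Longrightarrow> h (x \<oplus>\<^bsub>L\<^esub> y) = h (x' \<oplus>\<^bsub>L\<^esub> y')"
    and smult: "\<And>a x x'. \<lbrakk>a \<in> carrier F; x \<in> carrier L; x' \<in> carrier L; h x = h x'\<rbrakk> \<Longrightarrow>
      h (a \<odot>\<^bsub>L\<^esub> x) = h (a \<odot>\<^bsub>L\<^esub> x')"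
    and bracket: "\<And>xs i x x'. \<lbrakk>length xs = n; set xs \<subseteq> carrier L; i < n; x \<in> carrier L;
      x' \<in> carrier L; h x = h x'\<rbrakk> \<Longrightarrow> h (bracket L (xs[i := x])) = h (bracket L (xs[i := x']))"
  shows "\<exists>Q :: ('f, 'd) n_lie. carrier Q = h ` carrier L \<and>
    (\<forall>x\<in>carrier L. \<forall>y\<in>carrier L. h x \<oplus>\<^bsub>Q\<^esub> h y = h (x \<oplus>\<^bsub>L\<^esub> y)) \<and>
    (\<forall>a\<in>carrier F. \<forall>x\<in>carrier L. a \<odot>\<^bsub>Q\<^esub> h x = h (a \<odot>\<^bsub>L\<^esub> x)) \<and>
    (\<forall>xs. length xs = n \<and> set xs \<subseteq> carrier L \<longrightarrow> bracket Q (map h xs) = h (bracket L xs)) \<and>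
    n_Lie_algebra n F Q"
proof -
  interpret L: n_Lie_algebra n F L by fact
  \<comment> \<open>A choice of one preimage for each value of \<open>h\<close>; the congruence
    hypotheses make the choice immaterial.\<close>
  define r where "r = inv_into (carrier L) h"
  have r: "r (h x) \<in> carrier L" "h (r (h x)) = h x" if "x \<in> carrier L" for x
    using that by (auto simp: r_def inv_into_into f_inv_into_f)
  have bracket_cong: "h (bracket L xs) = h (bracket L ys)"
    if lists: "length xs = n" "set xs \<subseteq> carrier L" "length ys = n" "set ys \<subseteq> carrier L"
      and eq: "\<And>i. i < n \<Longrightarrow> h (xs ! i) = h (ys ! i)" for xs ys
  proof -
    \<comment> \<open>The lists interpolate from \<open>xs\<close> at \<open>k = 0\<close> to
      \<open>ys\<close> at \<open>k = n\<close>. Passing from \<open>k\<close> to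
      \<open>Suc k\<close> changes only the entry at position \<open>k\<close>, so the one-argument
      hypothesis applies.\<close>
    have "h (bracket L (take k ys @ drop k xs)) = h (bracket L xs)" if "k \<le> n" for k
      using that
    proof (induction k)
      case (Suc k)
      let ?zs = "take k ys @ drop k xs"
      have *: "?zs[k := xs ! k] = ?zs" "?zs[k := ys ! k] = take (Suc k) ys @ drop (Suc k) xs"
        using Suc.prems lists
        by (auto intro!: nth_equalityI simp: nth_append nth_list_update less_Suc_eq)
      have "set ?zs \<subseteq> carrier L"
        using lists by (auto dest: in_set_takeD in_set_dropD)
      moreover have "xs ! k \<in> carrier L" "ys ! k \<in> carrier L"
        using lists Suc.prems by (auto dest: nth_mem)
      ultimately have "h (bracket L (?zs[k := ys ! k])) = h (bracket L (?zs[k := xs ! k]))"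
        using lists eq Suc.prems by (intro bracket) auto
      then show ?case using Suc * by simp
    qed simp
    from this[of n] show ?thesis using lists by simp
  qed
  define Q :: "('f, 'd) n_lie" where
    "Q = \<lparr>carrier = h ` carrier L, monoid.mult = undefined, one = undefined, zero = h \<zero>\<^bsub>L\<^esub>,
      add = (\<lambda>c d. h (r c \<oplus>\<^bsub>L\<^esub> r d)), smult = (\<lambda>a c. h (a \<odot>\<^bsub>L\<^esub> r c)),
      bracket = (\<lambda>cs. h (bracket L (map r cs)))\<rparr>"
  have Q_add: "h x \<oplus>\<^bsub>Q\<^esub> h y = h (x \<oplus>\<^bsub>L\<^esub> y)" if "x \<in> carrier L" "y \<in> carrier L" for x y
    using that r by (auto simp: Q_def intro: add)
  have Q_smult: "a \<odot>\<^bsub>Q\<^esub> h x = h (a \<odot>\<^bsub>L\<^esub> x)" if "a \<in> carrier F" "x \<in> carrier L" for a x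
    using that r by (auto simp: Q_def intro: smult)
  have Q_bracket: "bracket Q (map h xs) = h (bracket L xs)"
    if "length xs = n" "set xs \<subseteq> carrier L" for xs
  proof -
    \<comment> \<open>The chosen representatives may differ from \<open>xs\<close> in every position
      at once, hence the appeal to the congruence in all arguments.\<close>
    have "h (bracket L (map (r \<circ> h) xs)) = h (bracket L xs)"
      using that r by (intro bracket_cong) (auto simp: subset_code(1))
    then show ?thesis by (simp add: Q_def)
  qed
  have "n_Lie_algebra n F Q"
    by (rule n_Lie_algebra_hom_image[OF assms(1), where h = h])
      (simp_all add: Q_add Q_smult Q_bracket, simp_all add: Q_def)
  then show ?thesis
    using Q_add Q_smult Q_bracket by (intro exI[of _ Q]) (simp add: Q_def)
qed

section \<open>Congruence from a single membership function\<close>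

text \<open>Negation turns the upper bounds for \<open>\<nu>\<close> into lower bounds, so both
  components of a fuzzy ideal are instances: \<open>\<mu>\<close> itself and the negative of
  \<open>\<nu>\<close>. The maximum over the arguments of a bracket is replaced by a bound for each
  single argument.\<close>

locale n_Lie_fuzzy_ideal = n_Lie_algebra n F L
  for n :: nat and F (structure) and L :: "('f, 'a, 'b) n_lie_scheme" (structure) +
  fixes f :: "'a \<Rightarrow> real"
  assumes fuzzy_add: "\<lbrakk>x \<in> carrier L; y \<in> carrier L\<rbrakk> \<Longrightarrow> min (f x) (f y) \<le> f (x \<oplus>\<^bsub>L\<^esub> y)"
    and fuzzy_smult: "\<lbrakk>a \<in> carrier F; x \<in> carrier L\<rbrakk> \<Longrightarrow> f x \<le> f (a \<odot>\<^bsub>L\<^esub> x)"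
    and fuzzy_bracket:
      "\<lbrakk>length xs = n; set xs \<subseteq> carrier L; x \<in> set xs\<rbrakk> \<Longrightarrow> f x \<le> f (bracket L xs)"
begin

text \<open>Scaling by the zero of \<open>F\<close> sends \<open>x\<close> to zero and does not
  lower \<open>f\<close>. Later equalities with the value at zero thus reduce to one
  inequality.\<close>

lemma fuzzy_le_zero: "x \<in> carrier L \<Longrightarrow> f x \<le> f \<zero>\<^bsub>L\<^esub>"
  using fuzzy_smult[of "\<zero>\<^bsub>F\<^esub>" x] by simp

text \<open>Scaling by minus one, applied to \<open>x\<close> and to its negative, gives the two
  inequalities.\<close>

lemma fuzzy_minus: "x \<in> carrier L \<Longrightarrow> f (\<ominus>\<^bsub>L\<^esub> x) = f x"
  using fuzzy_smult[of "\<ominus>\<^bsub>F\<^esub> \<one>\<^bsub>F\<^esub>" x] fuzzy_smult[of "\<ominus>\<^bsub>F\<^esub> \<one>\<^bsub>F\<^esub>" "\<ominus>\<^bsub>L\<^esub> x"]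
  by (simp add: smult_l_minus)

lemma fuzzy_add_eq_zero:
  assumes "x \<in> carrier L" "y \<in> carrier L" "f x = f \<zero>\<^bsub>L\<^esub>" "f y = f \<zero>\<^bsub>L\<^esub>"
  shows "f (x \<oplus>\<^bsub>L\<^esub> y) = f \<zero>\<^bsub>L\<^esub>"
  using assms fuzzy_add[of x y] fuzzy_le_zero[of "x \<oplus>\<^bsub>L\<^esub> y"] by simp

text \<open>One direction evaluates at \<open>z = x\<close>. For the other, z - y = (z - x) + (x -
  y), and adding an element at which \<open>f\<close> is maximal does not lower
  \<open>f\<close>.\<close>

lemma fuzzy_translate_eq_iff:
  assumes "x \<in> carrier L" "y \<in> carrier L"
  shows "(\<forall>z\<in>carrier L. f (z \<ominus>\<^bsub>L\<^esub> x) = f (z \<ominus>\<^bsub>L\<^esub> y)) \<longleftrightarrow> f (x \<ominus>\<^bsub>L\<^esub> y) = f \<zero>\<^bsub>L\<^esub>"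
proof
  assume "\<forall>z\<in>carrier L. f (z \<ominus>\<^bsub>L\<^esub> x) = f (z \<ominus>\<^bsub>L\<^esub> y)"
  then have "f (x \<ominus>\<^bsub>L\<^esub> y) = f (x \<ominus>\<^bsub>L\<^esub> x)" using assms by simp
  then show "f (x \<ominus>\<^bsub>L\<^esub> y) = f \<zero>\<^bsub>L\<^esub>" using assms by (simp add: M.minus_eq M.r_neg)
next
  have le: "f (z \<ominus>\<^bsub>L\<^esub> u) \<le> f (z \<ominus>\<^bsub>L\<^esub> v)"
    if "u \<in> carrier L" "v \<in> carrier L" "z \<in> carrier L" "f (u \<ominus>\<^bsub>L\<^esub> v) = f \<zero>\<^bsub>L\<^esub>" for u v z
  proof -
    have "(z \<ominus>\<^bsub>L\<^esub> u) \<oplus>\<^bsub>L\<^esub> (u \<ominus>\<^bsub>L\<^esub> v) = z \<ominus>\<^bsub>L\<^esub> v"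
      using that by (simp add: M.minus_eq M.a_assoc M.r_neg1)
    then show ?thesis
      using fuzzy_add[of "z \<ominus>\<^bsub>L\<^esub> u" "u \<ominus>\<^bsub>L\<^esub> v"] fuzzy_le_zero[of "z \<ominus>\<^bsub>L\<^esub> u"] that by simp
  qed
  assume eq: "f (x \<ominus>\<^bsub>L\<^esub> y) = f \<zero>\<^bsub>L\<^esub>"
  \<comment> \<open>The hypothesis is symmetric in \<open>x\<close> and \<open>y\<close>, so
    \<open>le\<close> yields both inequalities.\<close>
  moreover have "f (y \<ominus>\<^bsub>L\<^esub> x) = f (x \<ominus>\<^bsub>L\<^esub> y)"
    using assms fuzzy_minus[of "x \<ominus>\<^bsub>L\<^esub> y"] by (simp add: M.minus_eq M.minus_add M.a_comm)
  ultimately show "\<forall>z\<in>carrier L. f (z \<ominus>\<^bsub>L\<^esub> x) = f (z \<ominus>\<^bsub>L\<^esub> y)"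
    using le assms by (auto intro!: antisym)
qed

lemma fuzzy_add_cong:
  assumes "x \<in> carrier L" "x' \<in> carrier L" "y \<in> carrier L" "y' \<in> carrier L"
    and "f (x \<ominus>\<^bsub>L\<^esub> x') = f \<zero>\<^bsub>L\<^esub>" "f (y \<ominus>\<^bsub>L\<^esub> y') = f \<zero>\<^bsub>L\<^esub>"
  shows "f ((x \<oplus>\<^bsub>L\<^esub> y) \<ominus>\<^bsub>L\<^esub> (x' \<oplus>\<^bsub>L\<^esub> y')) = f \<zero>\<^bsub>L\<^esub>"
proof -
  have "(x \<oplus>\<^bsub>L\<^esub> y) \<ominus>\<^bsub>L\<^esub> (x' \<oplus>\<^bsub>L\<^esub> y') = (x \<ominus>\<^bsub>L\<^esub> x') \<oplus>\<^bsub>L\<^esub> (y \<ominus>\<^bsub>L\<^esub> y')"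
    using assms(1-4) by (simp add: M.minus_eq M.minus_add M.a_ac)
  then show ?thesis using assms by (simp add: fuzzy_add_eq_zero)
qed

lemma fuzzy_smult_cong:
  assumes "a \<in> carrier F" "x \<in> carrier L" "x' \<in> carrier L" "f (x \<ominus>\<^bsub>L\<^esub> x') = f \<zero>\<^bsub>L\<^esub>"
  shows "f (a \<odot>\<^bsub>L\<^esub> x \<ominus>\<^bsub>L\<^esub> a \<odot>\<^bsub>L\<^esub> x') = f \<zero>\<^bsub>L\<^esub>"
proof -
  have "a \<odot>\<^bsub>L\<^esub> x \<ominus>\<^bsub>L\<^esub> a \<odot>\<^bsub>L\<^esub> x' = a \<odot>\<^bsub>L\<^esub> (x \<ominus>\<^bsub>L\<^esub> x')"
    using assms by (simp add: M.minus_eq smult_r_distr smult_r_minus)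
  then show ?thesis
    using assms fuzzy_smult[of a "x \<ominus>\<^bsub>L\<^esub> x'"] fuzzy_le_zero[of "a \<odot>\<^bsub>L\<^esub> (x \<ominus>\<^bsub>L\<^esub> x')"] by simp
qed

text \<open>By additivity in position \<open>i\<close>, the difference of the two brackets is a
  single bracket with x - x' in that position. The ideal condition bounds its value below by the
  value at this one entry, which is already maximal.\<close>

lemma fuzzy_bracket_cong:
  assumes "length xs = n" "set xs \<subseteq> carrier L" "i < n" "x \<in> carrier L" "x' \<in> carrier L"
    and "f (x \<ominus>\<^bsub>L\<^esub> x') = f \<zero>\<^bsub>L\<^esub>"
  shows "f (bracket L (xs[i := x]) \<ominus>\<^bsub>L\<^esub> bracket L (xs[i := x'])) = f \<zero>\<^bsub>L\<^esub>"
proof -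
  have upd: "set (xs[i := z]) \<subseteq> carrier L" if "z \<in> carrier L" for z
    using that assms(2) set_update_subset_insert by fast
  have closed: "bracket L (xs[i := z]) \<in> carrier L" if "z \<in> carrier L" for z
    using that upd assms(1) by (simp add: bracket_closed)
  have "x = (x \<ominus>\<^bsub>L\<^esub> x') \<oplus>\<^bsub>L\<^esub> x'"
    using assms by (simp add: M.minus_eq M.a_assoc M.l_neg)
  then have "bracket L (xs[i := x]) =
      bracket L (xs[i := x \<ominus>\<^bsub>L\<^esub> x']) \<oplus>\<^bsub>L\<^esub> bracket L (xs[i := x'])"
    using assms bracket_add[of xs i "x \<ominus>\<^bsub>L\<^esub> x'" x'] by simp
  then have "bracket L (xs[i := x]) \<ominus>\<^bsub>L\<^esub> bracket L (xs[i := x']) =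
      bracket L (xs[i := x \<ominus>\<^bsub>L\<^esub> x'])"
    using assms closed by (simp add: M.minus_eq M.a_assoc M.r_neg)
  moreover have "f (x \<ominus>\<^bsub>L\<^esub> x') \<le> f (bracket L (xs[i := x \<ominus>\<^bsub>L\<^esub> x']))"
    using assms upd by (intro fuzzy_bracket) (auto simp: set_update_memI)
  ultimately show ?thesis
    using assms closed fuzzy_le_zero[of "bracket L (xs[i := x \<ominus>\<^bsub>L\<^esub> x'])"] by simp
qed

end

section \<open>The algebra of cosets\<close>

theorem theorem7p1:
  fixes n :: nat
    and F :: "('f, 'c) ring_scheme"
    and L :: "('f, 'a, 'b) n_lie_scheme"
    and A :: "('a \<Rightarrow> real) \<times> ('a \<Rightarrow> real)"
  assumes "n_Lie_algebra n F L"
    and "intuitionistic_fuzzy_n_Lie_ideal n F L A"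
  shows "\<exists>Q :: ('f, ('a \<Rightarrow> real) \<times> ('a \<Rightarrow> real)) n_lie.
    carrier Q = {fuzzy_coset L A x | x. x \<in> carrier L} \<and>
    (\<forall>x\<in>carrier L. \<forall>y\<in>carrier L.
       fuzzy_coset L A x \<oplus>\<^bsub>Q\<^esub> fuzzy_coset L A y = fuzzy_coset L A (x \<oplus>\<^bsub>L\<^esub> y)) \<and>
    (\<forall>a\<in>carrier F. \<forall>x\<in>carrier L.
       a \<odot>\<^bsub>Q\<^esub> fuzzy_coset L A x = fuzzy_coset L A (a \<odot>\<^bsub>L\<^esub> x)) \<and>
    (\<forall>xs. length xs = n \<and> set xs \<subseteq> carrier L \<longrightarrow>
       bracket Q (map (fuzzy_coset L A) xs) = fuzzy_coset L A (bracket L xs)) \<and>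
    n_Lie_algebra n F Q"
proof -
  obtain \<mu> \<nu> where A: "A = (\<mu>, \<nu>)" by fastforce
  interpret L: n_Lie_algebra n F L by fact
  have add: "min (\<mu> x) (\<mu> y) \<le> \<mu> (x \<oplus>\<^bsub>L\<^esub> y)" "\<nu> (x \<oplus>\<^bsub>L\<^esub> y) \<le> max (\<nu> x) (\<nu> y)"
    if "x \<in> carrier L" "y \<in> carrier L" for x y
    using assms(2) that unfolding A intuitionistic_fuzzy_n_Lie_ideal_def prod.case by blast+
  have smult: "\<mu> x \<le> \<mu> (a \<odot>\<^bsub>L\<^esub> x)" "\<nu> (a \<odot>\<^bsub>L\<^esub> x) \<le> \<nu> x"
    if "a \<in> carrier F" "x \<in> carrier L" for a x
    using assms(2) that unfolding A intuitionistic_fuzzy_n_Lie_ideal_def prod.case by blast+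
  have bracket: "\<mu> x \<le> \<mu> (bracket L xs)" "\<nu> (bracket L xs) \<le> \<nu> x"
    if "length xs = n" "set xs \<subseteq> carrier L" "x \<in> set xs" for xs x
  proof -
    have "Max (\<mu> ` set xs) \<le> \<mu> (bracket L xs)" "\<nu> (bracket L xs) \<le> Min (\<nu> ` set xs)"
      using assms(2) that unfolding A intuitionistic_fuzzy_n_Lie_ideal_def prod.case by blast+
    \<comment> \<open>The list entries form a finite set, so its extreme values bound the value at
      \<open>x\<close>.\<close>
    moreover have "\<mu> x \<le> Max (\<mu> ` set xs)" "Min (\<nu> ` set xs) \<le> \<nu> x"
      using that by auto
    ultimately show "\<mu> x \<le> \<mu> (bracket L xs)" "\<nu> (bracket L xs) \<le> \<nu> x" by linarith+
  qed
  interpret \<mu>: n_Lie_fuzzy_ideal n F L \<mu>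
    by unfold_locales (fact add smult bracket)+
  interpret \<nu>: n_Lie_fuzzy_ideal n F L "\<lambda>x. - \<nu> x"
  proof
    show "min (- \<nu> x) (- \<nu> y) \<le> - \<nu> (x \<oplus>\<^bsub>L\<^esub> y)" if "x \<in> carrier L" "y \<in> carrier L" for x y
      using add(2)[OF that] by linarith
  qed (simp_all add: smult bracket)
  \<comment> \<open>Restriction to the carrier makes equality of the component functions the same as
    pointwise equality on \<open>L\<close>. The minus signs keep the second conjunct in the form of
    the facts about the negative of \<open>\<nu>\<close>.\<close>
  have coset_eq: "fuzzy_coset L A x = fuzzy_coset L A y \<longleftrightarrow>
      \<mu> (x \<ominus>\<^bsub>L\<^esub> y) = \<mu> \<zero>\<^bsub>L\<^esub> \<and> - \<nu> (x \<ominus>\<^bsub>L\<^esub> y) = - \<nu> \<zero>\<^bsub>L\<^esub>"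
    if "x \<in> carrier L" "y \<in> carrier L" for x y
  proof -
    have "fuzzy_coset L A x = fuzzy_coset L A y \<longleftrightarrow>
        (\<forall>z\<in>carrier L. \<mu> (z \<ominus>\<^bsub>L\<^esub> x) = \<mu> (z \<ominus>\<^bsub>L\<^esub> y)) \<and>
        (\<forall>z\<in>carrier L. - \<nu> (z \<ominus>\<^bsub>L\<^esub> x) = - \<nu> (z \<ominus>\<^bsub>L\<^esub> y))"
      unfolding A fuzzy_coset_def by (simp add: restrict_def fun_eq_iff) blast
    then show ?thesis
      using \<mu>.fuzzy_translate_eq_iff[OF that] \<nu>.fuzzy_translate_eq_iff[OF that] by simp
  qed
  have upd: "set (xs[i := x]) \<subseteq> carrier L" if "set xs \<subseteq> carrier L" "x \<in> carrier L" for xs i x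
    using that set_update_subset_insert by fast
  \<comment> \<open>The same claim with the set of cosets written as an image, so that the quotient
    lemma applies with the coset map as \<open>h\<close>; its three premises are the congruences for
    the two components together.\<close>
  have "\<exists>Q :: ('f, ('a \<Rightarrow> real) \<times> ('a \<Rightarrow> real)) n_lie.
    carrier Q = fuzzy_coset L A ` carrier L \<and>
    (\<forall>x\<in>carrier L. \<forall>y\<in>carrier L.
       fuzzy_coset L A x \<oplus>\<^bsub>Q\<^esub> fuzzy_coset L A y = fuzzy_coset L A (x \<oplus>\<^bsub>L\<^esub> y)) \<and>
    (\<forall>a\<in>carrier F. \<forall>x\<in>carrier L.
       a \<odot>\<^bsub>Q\<^esub> fuzzy_coset L A x = fuzzy_coset L A (a \<odot>\<^bsub>L\<^esub> x)) \<and>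
    (\<forall>xs. length xs = n \<and> set xs \<subseteq> carrier L \<longrightarrow>
       bracket Q (map (fuzzy_coset L A) xs) = fuzzy_coset L A (bracket L xs)) \<and>
    n_Lie_algebra n F Q"
  proof (rule n_Lie_algebra_quotient[OF assms(1)])
    fix x x' y y' assume "x \<in> carrier L" "x' \<in> carrier L" "y \<in> carrier L" "y' \<in> carrier L"
      "fuzzy_coset L A x = fuzzy_coset L A x'" "fuzzy_coset L A y = fuzzy_coset L A y'"
    then show "fuzzy_coset L A (x \<oplus>\<^bsub>L\<^esub> y) = fuzzy_coset L A (x' \<oplus>\<^bsub>L\<^esub> y')"
      using \<mu>.fuzzy_add_cong[of x x' y y'] \<nu>.fuzzy_add_cong[of x x' y y'] by (simp add: coset_eq)
  next
    fix a x x' assume "a \<in> carrier F" "x \<in> carrier L" "x' \<in> carrier L"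
      "fuzzy_coset L A x = fuzzy_coset L A x'"
    then show "fuzzy_coset L A (a \<odot>\<^bsub>L\<^esub> x) = fuzzy_coset L A (a \<odot>\<^bsub>L\<^esub> x')"
      using \<mu>.fuzzy_smult_cong[of a x x'] \<nu>.fuzzy_smult_cong[of a x x'] by (simp add: coset_eq)
  next
    fix xs i x x' assume "length xs = n" "set xs \<subseteq> carrier L" "i < n"
      "x \<in> carrier L" "x' \<in> carrier L" "fuzzy_coset L A x = fuzzy_coset L A x'"
    then show "fuzzy_coset L A (bracket L (xs[i := x])) = fuzzy_coset L A (bracket L (xs[i := x']))"
      using \<mu>.fuzzy_bracket_cong[of xs i x x'] \<nu>.fuzzy_bracket_cong[of xs i x x']
        upd L.bracket_closed by (simp add: coset_eq)
  qed
  then show ?thesis by (simp add: image_def Collect_conj_eq Bex_def conj_commute)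
qed

end
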